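(* An element $g\in F_2$ belongs to the image $\mathrm{Pal}(F_2)$ if and only if $abg$ and $bag$ are conjugate in $F_2$.
   Context: $F_2$ is the free group on $a,b$. $w\mapsto R_w$ is the group homomorphism $F_2\to\mathrm{Aut}(F_2)$ with $R_a(a)=a$, $R_a(b)=ba$, $R_b(a)=ab$, $R_b(b)=b$. The palindromization map $\mathrm{Pal}:F_2\to F_2$ is defined by $\mathrm{Pal}(w)=b^{-1}a^{-1}R_w(ab)$. *)

theory Defs
  imports "HOL-Algebra.Algebra"
begin

section \<open>Free groups as groups of reduced words\<close>

text \<open>The letter \<open>(x, True)\<close> stands for the generator \<open>x\<close>, and \<open>(x, False)\<close> for its formal inverse.\<close>

type_synonym 'a letter = "'a \<times> bool"

definition inv_letter :: "'a letter \<Rightarrow> 'a letter" where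
  "inv_letter l = (fst l, \<not> snd l)"

fun reduced :: "'a letter list \<Rightarrow> bool" where
  "reduced (l # m # w) \<longleftrightarrow> m \<noteq> inv_letter l \<and> reduced (m # w)"
| "reduced w \<longleftrightarrow> True"

fun red_cons :: "'a letter \<Rightarrow> 'a letter list \<Rightarrow> 'a letter list" where
  "red_cons l [] = [l]"
| "red_cons l (m # w) = (if m = inv_letter l then w else l # m # w)"

text \<open>The product of \<open>u\<close> and \<open>v\<close> is the free reduction of the concatenation \<open>u @ v\<close>.\<close>

definition free_group :: "'a letter list monoid" where
  "free_group = \<lparr>carrier = {w. reduced w}, monoid.mult = foldr red_cons, one = []\<rparr>"

definition free_gen :: "'a \<Rightarrow> 'a letter list" where
  "free_gen x = [(x, True)]"

text \<open>The homomorphism to a group \<open>G\<close> that extends a map \<open>f\<close> on the generators; it is the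
  unique one by \<open>free_lift_hom\<close>, \<open>free_lift_gen\<close> and \<open>free_lift_unique\<close> below.\<close>

definition free_lift :: "('b, 'c) monoid_scheme \<Rightarrow> ('a \<Rightarrow> 'b) \<Rightarrow> 'a letter list \<Rightarrow> 'b" where
  "free_lift G f w =
     foldr (\<lambda>(x, pos) g. (if pos then f x else inv\<^bsub>G\<^esub> (f x)) \<otimes>\<^bsub>G\<^esub> g) w \<one>\<^bsub>G\<^esub>"

lemma inv_letter_inv_letter [simp]: "inv_letter (inv_letter l) = l"
  by (simp add: inv_letter_def)

lemma reduced_Cons: "reduced (l # w) \<longleftrightarrow> reduced w \<and> (w = [] \<or> hd w \<noteq> inv_letter l)"
  by (cases w) auto

lemma reduced_red_cons: "reduced w \<Longrightarrow> reduced (red_cons l w)"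
  by (cases w) (auto simp: reduced_Cons)

lemma red_cons_inv:
  assumes "reduced w" shows "red_cons (inv_letter l) (red_cons l w) = w"
proof (cases w)
  case (Cons m v)
  then show ?thesis using assms by (cases v) auto
qed simp

lemma red_cons_reduced: "reduced (l # w) \<Longrightarrow> red_cons l w = l # w"
  by (cases w) auto

lemma reduced_foldr: "reduced v \<Longrightarrow> reduced (foldr red_cons u v)"
  by (induction u) (auto intro: reduced_red_cons)

lemma foldr_red_cons:
  assumes "reduced w"
  shows "foldr red_cons (red_cons l u) w = red_cons l (foldr red_cons u w)"
proof (cases u)
  case (Cons m v)
  have "red_cons l (red_cons (inv_letter l) (foldr red_cons v w)) = foldr red_cons v w"
    using red_cons_inv[of "foldr red_cons v w" "inv_letter l"] assms by (simp add: reduced_foldr)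
  then show ?thesis using Cons by auto
qed simp

lemma foldr_red_assoc:
  "reduced w \<Longrightarrow>
   foldr red_cons (foldr red_cons u v) w = foldr red_cons u (foldr red_cons v w)"
  by (induction u) (auto simp: foldr_red_cons)

lemma foldr_red_Nil: "reduced u \<Longrightarrow> foldr red_cons u [] = u"
  by (induction u) (auto simp: reduced_Cons red_cons_reduced)

lemma foldr_red_inv:
  "reduced w \<Longrightarrow> foldr red_cons (map inv_letter (rev w)) w = []"
proof (induction w)
  case (Cons l w)
  then show ?case by (simp add: reduced_Cons)
qed simp

lemma group_free_group: "group free_group"
proof (rule groupI)
  fix x :: "'a letter list" assume x: "x \<in> carrier free_group"
  have "reduced (foldr red_cons (map inv_letter (rev x)) [])"
    by (rule reduced_foldr) simp
  moreover have "foldr red_cons (foldr red_cons (map inv_letter (rev x)) []) x = []"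
    using x foldr_red_inv[of x] by (simp add: foldr_red_assoc free_group_def)
  ultimately show "\<exists>y\<in>carrier free_group. y \<otimes>\<^bsub>free_group\<^esub> x = \<one>\<^bsub>free_group\<^esub>"
    by (auto simp: free_group_def)
qed (auto simp: free_group_def reduced_foldr foldr_red_assoc)

lemma free_gen_closed [simp]: "free_gen x \<in> carrier free_group"
  by (simp add: free_gen_def free_group_def)

lemma inv_free_gen: "inv\<^bsub>free_group\<^esub> (free_gen x) = [(x, False)]"
  by (rule group.inv_equality[OF group_free_group])
    (auto simp: free_gen_def free_group_def inv_letter_def)

context group
begin

lemma free_lift_Cons:
  "free_lift G f ((x, pos) # w) = (if pos then f x else inv (f x)) \<otimes> free_lift G f w"
  by (simp add: free_lift_def)

lemma free_lift_closed [simp]: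
  assumes "\<And>x. f x \<in> carrier G" shows "free_lift G f w \<in> carrier G"
  by (induction w) (use assms in \<open>auto simp: free_lift_def\<close>)

lemma free_lift_red_cons:
  assumes f: "\<And>x. f x \<in> carrier G"
  shows "free_lift G f (red_cons (x, pos) w)
       = (if pos then f x else inv (f x)) \<otimes> free_lift G f w"
proof (cases w)
  case (Cons m v)
  show ?thesis
    using f by (cases m) (auto simp: Cons free_lift_Cons inv_letter_def m_assoc[symmetric])
qed (simp add: free_lift_Cons)

lemma free_lift_hom:
  fixes f :: "'c \<Rightarrow> 'a"
  assumes f: "\<And>x. f x \<in> carrier G" shows "free_lift G f \<in> hom free_group G"
proof (rule homI)
  fix u v :: "'c letter list"
  have "free_lift G f (foldr red_cons u v) = free_lift G f u \<otimes> free_lift G f v"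
  proof (induction u)
    case Nil
    show ?case using f by (simp add: free_lift_def[of G f "[]"])
  next
    case (Cons l u)
    then show ?case
      using f by (cases l) (simp add: free_lift_red_cons free_lift_Cons m_assoc)
  qed
  then show "free_lift G f (u \<otimes>\<^bsub>free_group\<^esub> v) = free_lift G f u \<otimes> free_lift G f v"
    by (simp add: free_group_def)
qed (use f in simp)

lemma free_lift_gen: "f x \<in> carrier G \<Longrightarrow> free_lift G f (free_gen x) = f x"
  by (simp add: free_lift_def free_gen_def)

lemma free_lift_unique:
  assumes h: "h \<in> hom free_group G" and hf: "\<And>x. h (free_gen x) = f x"
    and w: "w \<in> carrier free_group"
  shows "h w = free_lift G f w"
proof -
  interpret F: group "free_group :: 'c letter list monoid" by (rule group_free_group)
  interpret h: group_hom free_group G h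
    using h by unfold_locales
  have "reduced w" using w by (simp add: free_group_def)
  then show ?thesis
  proof (induction w)
    case Nil
    then show ?case using h.hom_one by (simp add: free_lift_def free_group_def)
  next
    case (Cons l w)
    obtain x pos where l: "l = (x, pos)" by (cases l)
    have eq: "l # w = [l] \<otimes>\<^bsub>free_group\<^esub> w" and cl: "w \<in> carrier free_group"
      using Cons.prems by (auto simp: free_group_def red_cons_reduced reduced_Cons)
    have hl: "h [l] = (if pos then f x else inv (f x))"
      using h.hom_inv[OF free_gen_closed[of x]]
      by (auto simp: l hf inv_free_gen simp flip: free_gen_def)
    have "h (l # w) = h [l] \<otimes> h w"
      unfolding eq using cl by (intro h.hom_mult) (simp_all add: free_group_def)
    then show ?case
      using Cons by (simp add: hl[unfolded l] l free_lift_Cons reduced_Cons)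
  qed
qed

end

section \<open>Conjugacy\<close>

definition conjugate_in :: "('a, 'b) monoid_scheme \<Rightarrow> 'a \<Rightarrow> 'a \<Rightarrow> bool" where
  "conjugate_in G x y \<longleftrightarrow> (\<exists>h\<in>carrier G. y = h \<otimes>\<^bsub>G\<^esub> x \<otimes>\<^bsub>G\<^esub> inv\<^bsub>G\<^esub> h)"

section \<open>The free group on two generators and the palindromization map\<close>

datatype gen = GenA | GenB

abbreviation F2 :: "gen letter list monoid" where
  "F2 \<equiv> free_group"

abbreviation gen_a :: "gen letter list" where
  "gen_a \<equiv> free_gen GenA"

abbreviation gen_b :: "gen letter list" where
  "gen_b \<equiv> free_gen GenB"

text \<open>\<open>F2_endo u v\<close> is the endomorphism with \<open>a \<mapsto> u\<close> and \<open>b \<mapsto> v\<close>; it is restricted to the carrier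
  because the elements of \<^const>\<open>AutoGroup\<close> are extensional functions.\<close>

definition F2_endo :: "gen letter list \<Rightarrow> gen letter list \<Rightarrow> gen letter list \<Rightarrow> gen letter list"
  where "F2_endo u v = restrict (free_lift F2 (case_gen u v)) (carrier F2)"

definition R_gen :: "gen \<Rightarrow> gen letter list \<Rightarrow> gen letter list" where
  "R_gen x = (case x of
      GenA \<Rightarrow> F2_endo gen_a (gen_b \<otimes>\<^bsub>F2\<^esub> gen_a)
    | GenB \<Rightarrow> F2_endo (gen_a \<otimes>\<^bsub>F2\<^esub> gen_b) gen_b)"

definition R_aut :: "gen letter list \<Rightarrow> gen letter list \<Rightarrow> gen letter list" where
  "R_aut = free_lift (AutoGroup F2) R_gen"

definition Pal :: "gen letter list \<Rightarrow> gen letter list" where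
  "Pal w = inv\<^bsub>F2\<^esub> gen_b \<otimes>\<^bsub>F2\<^esub> inv\<^bsub>F2\<^esub> gen_a \<otimes>\<^bsub>F2\<^esub> R_aut w (gen_a \<otimes>\<^bsub>F2\<^esub> gen_b)"

interpretation F2: group F2
  by (rule group_free_group)

lemma F2_endo_hom:
  assumes "u \<in> carrier F2" "v \<in> carrier F2"
  shows "F2_endo u v \<in> hom F2 F2"
proof -
  have "free_lift F2 (case_gen u v) \<in> hom F2 F2"
    by (rule F2.free_lift_hom) (use assms in \<open>auto split: gen.split\<close>)
  then show ?thesis by (auto simp: F2_endo_def hom_def)
qed

lemma F2_endo_inv:
  assumes "u \<in> carrier F2" "v \<in> carrier F2" "w \<in> carrier F2"
  shows "F2_endo u v (inv\<^bsub>F2\<^esub> w) = inv\<^bsub>F2\<^esub> (F2_endo u v w)"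
  using F2_endo_hom[OF assms(1,2)] assms(3)
  by (intro group_hom.hom_inv) (auto intro: group_hom.intro group_hom_axioms.intro F2.group_axioms)

lemma F2_endo_gen:
  assumes "u \<in> carrier F2" "v \<in> carrier F2"
  shows "F2_endo u v gen_a = u" "F2_endo u v gen_b = v"
  using assms by (auto simp: F2_endo_def F2.free_lift_gen)

lemma F2_hom_id:
  assumes "h \<in> hom F2 F2" "h gen_a = gen_a" "h gen_b = gen_b" "w \<in> carrier F2"
  shows "h w = w"
proof -
  have "h w = free_lift F2 free_gen w"
  proof (rule F2.free_lift_unique[OF assms(1) _ assms(4)])
    show "h (free_gen x) = free_gen x" for x using assms by (cases x) auto
  qed
  also have "free_lift F2 free_gen w = w"
    using F2.free_lift_unique[of "\<lambda>x. x" free_gen w] assms(4) by (simp add: hom_def)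
  finally show ?thesis .
qed

lemma F2_endo_auto:
  assumes "u \<in> carrier F2" "v \<in> carrier F2" "u' \<in> carrier F2" "v' \<in> carrier F2"
    and "F2_endo u' v' u = gen_a" "F2_endo u' v' v = gen_b"
    and "F2_endo u v u' = gen_a" "F2_endo u v v' = gen_b"
  shows "F2_endo u v \<in> carrier (AutoGroup F2)"
proof -
  let ?f = "F2_endo u v" and ?g = "F2_endo u' v'"
  have hf: "?f \<in> hom F2 F2" and hg: "?g \<in> hom F2 F2"
    using assms by (auto intro: F2_endo_hom)
  have gf: "?g (?f w) = w" if "w \<in> carrier F2" for w
    using F2_hom_id[OF hom_compose[OF hf hg] _ _ that] assms by (simp add: F2_endo_gen)
  have fg: "?f (?g w) = w" if "w \<in> carrier F2" for w
    using F2_hom_id[OF hom_compose[OF hg hf] _ _ that] assms by (simp add: F2_endo_gen)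
  have "bij_betw ?f (carrier F2) (carrier F2)"
    by (rule bij_betw_byWitness[where f' = ?g])
      (use gf fg hf hg in \<open>auto simp: hom_def Pi_iff\<close>)
  then show ?thesis
    using hf by (simp add: AutoGroup_def auto_def Bij_def F2_endo_def)
qed

lemma R_gen_auto: "R_gen x \<in> carrier (AutoGroup F2)"
proof (cases x)
  case GenA
  have "F2_endo gen_a (gen_b \<otimes>\<^bsub>F2\<^esub> gen_a) \<in> carrier (AutoGroup F2)"
    by (rule F2_endo_auto[where u' = gen_a and v' = "gen_b \<otimes>\<^bsub>F2\<^esub> inv\<^bsub>F2\<^esub> gen_a"])
      (simp_all add: F2_endo_gen hom_mult[OF F2_endo_hom] F2.m_assoc F2_endo_inv)
  then show ?thesis using GenA by (simp add: R_gen_def)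
next
  case GenB
  have "F2_endo (gen_a \<otimes>\<^bsub>F2\<^esub> gen_b) gen_b \<in> carrier (AutoGroup F2)"
    by (rule F2_endo_auto[where u' = "gen_a \<otimes>\<^bsub>F2\<^esub> inv\<^bsub>F2\<^esub> gen_b" and v' = gen_b])
      (simp_all add: F2_endo_gen hom_mult[OF F2_endo_hom] F2.m_assoc F2_endo_inv)
  then show ?thesis using GenB by (simp add: R_gen_def)
qed

lemma R_aut_hom: "R_aut \<in> hom F2 (AutoGroup F2)"
  unfolding R_aut_def by (rule group.free_lift_hom[OF F2.AutoGroup R_gen_auto])

lemma R_aut_free_gen: "R_aut (free_gen x) = R_gen x"
  unfolding R_aut_def by (rule group.free_lift_gen[OF F2.AutoGroup R_gen_auto])

lemma R_aut_values:
  "R_aut gen_a gen_a = gen_a" "R_aut gen_a gen_b = gen_b \<otimes>\<^bsub>F2\<^esub> gen_a"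
  "R_aut gen_b gen_a = gen_a \<otimes>\<^bsub>F2\<^esub> gen_b" "R_aut gen_b gen_b = gen_b"
  by (simp_all add: R_aut_free_gen R_gen_def F2_endo_gen)

end

theory Submission
  imports Defs
begin

text \<open>
  Write \<open>c = a b a\<inverse> b\<inverse>\<close>. Every \<open>R\<^sub>w\<close> fixes \<open>c\<close>, so \<open>x = R\<^sub>w(a)\<close> and \<open>y = R\<^sub>w(b)\<close> satisfy
  \<open>[x, y] = c\<close>; with \<open>a b Pal(w) = x y\<close> this gives \<open>b a Pal(w) = y x\<close>.
  Conversely, if \<open>b a g\<close> is the conjugate of \<open>x = a b g\<close> by \<open>h\<close>, then \<open>[x, h] = c\<close>, and it suffices
  that every solution of \<open>[x, y] = c\<close> has the form \<open>(R\<^sub>w(a), R\<^sub>w(b))\<close>. Up to simultaneous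
  conjugation these pairs are stable under all Nielsen moves of determinant one. Such moves
  shorten a solution of \<open>[x, y] \<sim> c\<close> unless \<open>x\<close> and \<open>y\<close> are both letters: in a solution that cannot be
  shortened the cancellations in \<open>x y x\<inverse> y\<inverse>\<close> leave an explicit cyclically reduced word, and its
  length has to be at most that of \<open>c\<close>. It remains to undo the conjugation. The conjugating element
  centralizes \<open>c\<close>, hence is a power of \<open>c\<close>, and conjugation by \<open>c\<close> is itself some \<open>R\<^sub>u\<close>.
\<close>

section \<open>Reduced words\<close>

abbreviation fmult :: "'a letter list \<Rightarrow> 'a letter list \<Rightarrow> 'a letter list" (infixl "\<bullet>" 70) where
  "u \<bullet> v \<equiv> u \<otimes>\<^bsub>free_group\<^esub> v"

abbreviation finv :: "'a letter list \<Rightarrow> 'a letter list" where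
  "finv u \<equiv> inv\<^bsub>free_group\<^esub> u"

interpretation free: group "free_group :: 'a letter list monoid"
  by (rule group_free_group)

lemma carrier_free_group: "w \<in> carrier free_group \<longleftrightarrow> reduced w"
  by (simp add: free_group_def)

lemma one_free_group: "\<one>\<^bsub>free_group\<^esub> = []"
  by (simp add: free_group_def)

lemma fmult_eq: "u \<bullet> v = foldr red_cons u v"
  by (simp add: free_group_def)

lemma (in group) mult_inv_cancel:
  assumes "x \<in> carrier G" "y \<in> carrier G"
  shows "x \<otimes> (inv x \<otimes> y) = y" "inv x \<otimes> (x \<otimes> y) = y"
  using assms by (simp_all flip: m_assoc)

text \<open>Right-associated products with neighbouring inverses cancelled: these rewrites check the
  group identities below by calculation.\<close>

lemmas free_simps = free.m_assoc free.inv_mult_group free.mult_inv_cancel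

text \<open>The inverse on the level of lists, where prefixes, suffixes and cancelled pieces can be
  tracked; on reduced words it agrees with \<open>finv\<close> by \<open>finv_eq\<close>.\<close>

definition winv :: "'a letter list \<Rightarrow> 'a letter list" where
  "winv w = map inv_letter (rev w)"

lemma winv_simps [simp]:
  "winv [] = []" "winv (l # w) = winv w @ [inv_letter l]" "winv (u @ v) = winv v @ winv u"
  "winv (winv w) = w" "length (winv w) = length w" "winv w = [] \<longleftrightarrow> w = []"
  by (simp_all add: winv_def rev_map comp_def)

lemma hd_winv [simp]: "w \<noteq> [] \<Longrightarrow> hd (winv w) = inv_letter (last w)"
  by (simp add: winv_def hd_map hd_rev)

lemma last_winv [simp]: "w \<noteq> [] \<Longrightarrow> last (winv w) = inv_letter (hd w)"
  by (simp add: winv_def last_map last_rev)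

lemma inv_letter_eq_iff [simp]: "inv_letter l = inv_letter m \<longleftrightarrow> l = m"
  by (metis inv_letter_inv_letter)

lemma inv_letter_neq [simp]: "inv_letter l \<noteq> l" "l \<noteq> inv_letter l"
  by (cases l; simp add: inv_letter_def)+

lemma reduced_append:
  "reduced (u @ v) \<longleftrightarrow>
     reduced u \<and> reduced v \<and> (u = [] \<or> v = [] \<or> hd v \<noteq> inv_letter (last u))"
proof (induction u)
  case (Cons l u)
  then show ?case by (cases u) (auto simp: reduced_Cons)
qed simp

text \<open>Reducedness concerns neighbouring letters only, and with a nonempty overlap every
  neighbouring pair lies in one of the two pieces.\<close>

lemma reduced_append_overlap:
  "reduced (u @ v) \<Longrightarrow> v \<noteq> [] \<Longrightarrow> reduced (v @ w) \<Longrightarrow> reduced (u @ v @ w)"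
  by (auto simp: reduced_append)

lemma reduced_winv [simp]: "reduced (winv w) \<longleftrightarrow> reduced w"
proof -
  have "reduced w \<Longrightarrow> reduced (winv w)" for w :: "'a letter list"
  proof (induction w)
    case (Cons l w)
    then show ?case by (cases "w = []") (auto simp: reduced_append reduced_Cons)
  qed simp
  from this[of w] this[of "winv w"] show ?thesis by auto
qed

lemma finv_eq: "reduced w \<Longrightarrow> finv w = winv w"
  by (rule free.inv_equality)
    (simp_all add: carrier_free_group fmult_eq one_free_group foldr_red_inv winv_def
        reduced_winv[unfolded winv_def])

lemma fmult_eq_append:
  assumes "reduced (u @ v)" shows "u \<bullet> v = u @ v"
proof -
  have "foldr red_cons (u @ v) [] = u @ v" "foldr red_cons v [] = v"
    using assms by (simp_all only: foldr_red_Nil reduced_append)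
  then show ?thesis by (simp add: fmult_eq)
qed

lemma length_fmult: "length (u \<bullet> v) \<le> length u + length v"
proof -
  have "length (red_cons l w) \<le> Suc (length w)" for l and w :: "'a letter list"
    by (cases w) auto
  then show ?thesis
    unfolding fmult_eq by (induction u) (auto intro: order_trans)
qed

lemma length_finv [simp]: "reduced w \<Longrightarrow> length (finv w) = length w"
  by (simp add: finv_eq)

text \<open>Letters leave the right end of \<open>u\<close> as long as they meet their inverses at
  the head of \<open>v\<close>; \<open>p\<close> collects them, and the remaining pieces fit
  together without cancellation.\<close>

lemma cancellationE:
  assumes "reduced u" "reduced v"
  obtains u' p v' where "u = u' @ p" "v = winv p @ v'" "reduced (u' @ v')" "u \<bullet> v = u' @ v'"
proof -
  have "\<exists>u' p v'. u = u' @ p \<and> v = winv p @ v' \<and> reduced (u' @ v')"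
    using assms
  proof (induction u arbitrary: v rule: rev_induct)
    case (snoc l u)
    show ?case
    proof (cases "reduced ((u @ [l]) @ v)")
      case True
      then show ?thesis by (intro exI[of _ "u @ [l]"] exI[of _ "[]"] exI[of _ v]) simp
    next
      case False
      then have "v \<noteq> []" "hd v = inv_letter l"
        using snoc.prems unfolding reduced_append by auto
      then obtain v1 where v1: "v = inv_letter l # v1" by (cases v) auto
      obtain u' p v' where "u = u' @ p" "v1 = winv p @ v'" "reduced (u' @ v')"
        using snoc.IH[of v1] snoc.prems unfolding v1 reduced_append by (auto simp: reduced_Cons)
      then show ?thesis
        unfolding v1 by (intro exI[of _ u'] exI[of _ "p @ [l]"] exI[of _ v']) simp
    qed
  qed (auto intro: exI[of _ "[]"])
  then obtain u' p v' where *: "u = u' @ p" "v = winv p @ v'" "reduced (u' @ v')" by blast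
  moreover have "u \<bullet> v = u' @ v'"
  proof -
    have "reduced p" "reduced v'" "reduced u'" using * assms by (auto simp: reduced_append)
    moreover have "u = u' \<bullet> p" "v = finv p \<bullet> v'" "u' @ v' = u' \<bullet> v'"
      using * assms \<open>reduced p\<close> by (simp_all add: fmult_eq_append finv_eq)
    ultimately show ?thesis by (simp add: free_simps flip: carrier_free_group)
  qed
  ultimately show thesis using that by blast
qed

section \<open>Powers and conjugates of cyclically reduced words\<close>

lemma nat_pow_cyc_reduced:
  assumes "reduced (w @ w)"
  shows "length (w [^]\<^bsub>free_group\<^esub> (n::nat)) = n * length w"
proof -
  have "reduced w" using assms by (simp add: reduced_append)
  \<comment> \<open>The second conjunct strengthens the induction: the next factor \<open>w\<close>
    meets the power without cancellation.\<close>
  have "length (w [^]\<^bsub>free_group\<^esub> n) = n * length w \<and>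
    reduced (w [^]\<^bsub>free_group\<^esub> n @ w)" for n
  proof (induction n)
    case 0
    then show ?case using \<open>reduced w\<close> by (simp add: one_free_group)
  next
    case (Suc n)
    then have "w [^]\<^bsub>free_group\<^esub> n \<bullet> w = w [^]\<^bsub>free_group\<^esub> n @ w"
      by (intro fmult_eq_append) simp
    then show ?case
      using Suc assms by (cases "w = []") (simp_all add: reduced_append)
  qed
  then show ?thesis by blast
qed

lemma (in group) nat_pow_conj:
  assumes "k \<in> carrier G" "w \<in> carrier G"
  shows "(k \<otimes> w \<otimes> inv k) [^] (n::nat) = k \<otimes> w [^] n \<otimes> inv k"
  using assms by (induction n) (simp_all add: m_assoc mult_inv_cancel)

text \<open>Comparing the lengths of the \<open>n\<close>-th powers of \<open>w\<close> and of its conjugate for large \<open>n\<close>.\<close>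

lemma cyc_reduced_length_le_conj:
  assumes w: "reduced (w @ w)" and k: "reduced k"
  shows "length w \<le> length (k \<bullet> w \<bullet> finv k)"
proof (rule ccontr)
  assume "\<not> ?thesis"
  then have less: "length (k \<bullet> w \<bullet> finv k) + 1 \<le> length w" by simp
  \<comment> \<open>The conjugating factors contribute at most \<open>2 * length k\<close> letters,
    while each of the \<open>n\<close> factors \<open>w\<close> is longer than \<open>v\<close> by
    at least one; \<open>n\<close> exceeds that contribution by one.\<close>
  define v n where "v = k \<bullet> w \<bullet> finv k" and "n = 2 * length k + 1"
  have rw: "w \<in> carrier free_group" "k \<in> carrier free_group"
    using w k by (simp_all add: reduced_append carrier_free_group)
  have pow_le: "length (v [^]\<^bsub>free_group\<^esub> (m::nat)) \<le> m * length v" for m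
  proof (induction m)
    case (Suc m)
    then show ?case using length_fmult[of "v [^]\<^bsub>free_group\<^esub> m" v] by simp
  qed (simp add: one_free_group)
  have "w [^]\<^bsub>free_group\<^esub> n = finv k \<bullet> v [^]\<^bsub>free_group\<^esub> n \<bullet> k"
    using rw unfolding v_def by (subst free.nat_pow_conj) (simp_all add: free_simps)
  then have "n * length w \<le> 2 * length k + n * length v"
    using nat_pow_cyc_reduced[OF w, of n] pow_le[of n] k
      length_fmult[of "finv k \<bullet> v [^]\<^bsub>free_group\<^esub> n" k]
      length_fmult[of "finv k" "v [^]\<^bsub>free_group\<^esub> n"] by simp
  moreover have "n * (length v + 1) \<le> n * length w"
    using less unfolding v_def by (rule mult_le_mono2)
  ultimately show False by (simp add: n_def)
qed

section \<open>Short commutators\<close>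

definition comm :: "'a letter list \<Rightarrow> 'a letter list \<Rightarrow> 'a letter list" where
  "comm x y = x \<bullet> y \<bullet> finv x \<bullet> finv y"

lemma comm_closed [simp]:
  "x \<in> carrier free_group \<Longrightarrow> y \<in> carrier free_group \<Longrightarrow> comm x y \<in> carrier free_group"
  by (simp add: comm_def)

lemma comm_conj:
  assumes "x \<in> carrier free_group" "y \<in> carrier free_group" "k \<in> carrier free_group"
  shows "comm (k \<bullet> x \<bullet> finv k) (k \<bullet> y \<bullet> finv k) = k \<bullet> comm x y \<bullet> finv k"
  using assms by (simp add: comm_def free_simps)

text \<open>The half of \<open>commutator_letters\<close> in which \<open>y\<close> does not cancel against
  \<open>finv x\<close> on the left.\<close>

lemma commutator_letters_aux:
  assumes x: "reduced x" "x \<noteq> []" "reduced (x @ x)" and y: "reduced y" "y \<noteq> []"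
    and le: "length x \<le> length y"
    and min: "length y \<le> length (x \<bullet> y)" "length y \<le> length (y \<bullet> x)"
      "length y \<le> length (y \<bullet> finv x)"
    and left: "hd y \<noteq> hd x"
    and ne: "comm x y \<noteq> []"
    and k: "reduced k" "length (k \<bullet> comm x y \<bullet> finv k) \<le> 4"
  shows "length x = 1 \<and> length y = 1"
proof -
  obtain x1 p y1 where p: "x = x1 @ p" "y = winv p @ y1" "reduced (x1 @ y1)" "x \<bullet> y = x1 @ y1"
    using cancellationE[OF x(1) y(1)] by blast
  \<comment> \<open>The product \<open>x \<bullet> y\<close> loses \<open>2 * length p\<close>
    letters, so minimality of \<open>length y\<close> limits the cancelled piece to half of
    \<open>x\<close>.\<close>
  have lp: "2 * length p \<le> length x" using min(1) p by simp
  have x1: "x1 \<noteq> []" and y1: "y1 \<noteq> []"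
    using lp p x y le by auto
  have cyc: "hd x \<noteq> inv_letter (last x)" using x by (simp add: reduced_append)
  \<comment> \<open>Used for the explicit cyclically reduced words below: none is longer than a
    conjugate of itself, and one conjugate has at most 4 letters.\<close>
  have bound: "length w \<le> 4" if "w = comm x y" "reduced (w @ w)" for w
    using cyc_reduced_length_le_conj[OF that(2) k(1)] k(2) that(1) by simp
  show ?thesis
  \<comment> \<open>The equality says that \<open>finv x\<close> and \<open>finv y\<close> cancel.
    If they do not, the possible cancellations are \<open>p\<close> between \<open>x\<close> and
    \<open>y\<close> and \<open>q\<close> between \<open>y\<close> and \<open>finv x\<close>; if
    they do, \<open>y\<close> and \<open>finv x\<close> do not cancel, because \<open>x\<close> is
    cyclically reduced.\<close>
  proof (cases "last y = inv_letter (hd x)")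
    case False
    have "reduced (winv x)" using x by simp
    then obtain y2 q z where q: "y = y2 @ q" "winv x = winv q @ z" "reduced (y2 @ z)"
        "y \<bullet> winv x = y2 @ z"
      using cancellationE[OF y(1)] by blast
    define x2 where "x2 = winv z"
    have xq: "x = x2 @ q" using arg_cong[OF q(2), of winv] by (simp add: x2_def)
    have z: "z = winv x2" by (simp add: x2_def)
    have lq: "2 * length q \<le> length x"
      using min(3) q x by (simp add: finv_eq xq z)
    have x2: "x2 \<noteq> []" using lq xq x by auto
    \<comment> \<open>Otherwise the two cancelled pieces are the two halves of \<open>y\<close>.
      Both \<open>p\<close> and \<open>q\<close> are then the same end of \<open>x\<close>, and
      \<open>y = winv p @ p\<close> is not reduced.\<close>
    have "length p + length q < length y"
    proof (rule ccontr)
      assume "\<not> ?thesis"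
      then have "length p = length q" "length y1 = length p"
        using lp lq le p by auto
      then have "p = q" "y1 = q"
        using p(1,2) xq q(1) by (metis append_eq_append_conv)+
      then show False using p(2) y y1 by (auto simp: reduced_append)
    qed
    then have "take (length y - length q) y = winv p @ take (length y1 - length q) y1"
      using p(2) by simp
    then obtain m where m: "y2 = winv p @ m"
      using q(1) by simp
    have ym: "y = winv p @ m @ q" using q(1) m by simp
    have m0: "m \<noteq> []" using \<open>length p + length q < length y\<close> ym by auto
    have y1m: "y1 = m @ q" using p(2) ym by simp
    define w where "w = x1 @ m @ winv x2 @ winv y"
    have red: "reduced x1" "reduced p" "reduced m" "reduced q" "reduced x2"
      using x(1)[unfolded p(1)] x(1)[unfolded xq] y(1)[unfolded ym]
      by (auto simp: reduced_append)
    have "x1 @ m @ winv x2 @ winv y = x1 \<bullet> (m \<bullet> (winv x2 \<bullet> winv y))" and ww: "reduced (w @ w)"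
    proof -
      have 1: "reduced (x1 @ m)"
        using p(3) m0 by (simp add: y1m reduced_append)
      have 2: "reduced (m @ winv x2)"
        using q(3) m0 by (simp add: m z reduced_append)
      have 3: "reduced (winv x2 @ winv y)"
        using x2 y False red by (simp add: reduced_append xq) (metis inv_letter_inv_letter)
      have 4: "reduced (winv y @ x1)"
        using x1 y left red p(1) by (simp add: reduced_append)
      note ov = reduced_append_overlap
      have 5: "reduced (winv x2 @ winv y @ x1)" using 3 4 y by (intro ov) auto
      show "reduced (w @ w)" unfolding w_def append_assoc
        using 1 2 3 4 x1 x2 y m0 by (intro ov) auto
      show "x1 @ m @ winv x2 @ winv y = x1 \<bullet> (m \<bullet> (winv x2 \<bullet> winv y))"
        using 1 2 3 m0 x2 ov by (metis fmult_eq_append winv_simps(6))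
    qed
    moreover have "comm x y = x1 \<bullet> (m \<bullet> (winv x2 \<bullet> winv y))"
    proof -
      have "comm x y = (x1 \<bullet> p) \<bullet> (finv p \<bullet> (m \<bullet> q)) \<bullet> finv (x2 \<bullet> q) \<bullet> finv y"
        using p(1) xq ym x(1) y(1) red
        by (simp add: comm_def fmult_eq_append finv_eq reduced_append)
      then show ?thesis
        using red y(1) by (simp add: free_simps flip: finv_eq carrier_free_group)
    qed
    ultimately have "length w \<le> 4" using bound[OF _ ww] by (simp add: w_def)
    moreover have "length m > 0" using m0 by simp
    moreover have "length y = length p + length m + length q" using ym by simp
    moreover have "length x1 + length p = length x" "length x2 + length q = length x"
      using arg_cong[OF p(1), of length] arg_cong[OF xq, of length] by simp_all
    moreover have "length x > 0" using x by simp
    \<comment> \<open>The length of \<open>w\<close> is \<open>2 * length x + 2 * length m\<close>,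
      which leaves one letter each; half of a single letter is empty, hence so are \<open>p\<close>
      and \<open>q\<close>.\<close>
    ultimately have "length x = 1" "length m = 1" "length p = 0" "length q = 0"
      using lp lq unfolding w_def length_append winv_simps by linarith+
    then show ?thesis by (simp add: ym)
  next
    case True
    obtain y2 q x2 where q: "y = y2 @ q" "x = winv q @ x2" "reduced (y2 @ x2)" "y \<bullet> x = y2 @ x2"
      using cancellationE[OF y(1) x(1)] by blast
    have lq: "2 * length q \<le> length x" using min(2) q by simp
    have x2: "x2 \<noteq> []" and y2: "y2 \<noteq> []"
      using lq q x y le by auto
    define w where "w = x1 @ y1 @ winv x2 @ winv y2"
    have red: "reduced x1" "reduced p" "reduced y1" "reduced q" "reduced x2" "reduced y2"
      using x(1)[unfolded p(1)] x(1)[unfolded q(2)] y(1)[unfolded p(2)] y(1)[unfolded q(1)]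
      by (auto simp: reduced_append)
    have "x1 @ y1 @ winv x2 @ winv y2 = x1 \<bullet> (y1 \<bullet> (winv x2 \<bullet> winv y2))"
      and ww: "reduced (w @ w)"
    proof -
      note ov = reduced_append_overlap
      have lasts: "last y1 = last y" "last x2 = last x" "hd y2 = hd y" "hd x1 = hd x"
        using p(2) q(2) y1 x2 q(1) y2 p(1) x1 by (metis last_appendR hd_append2)+
      have 2: "reduced (y1 @ winv x2)"
        using True cyc red x2 y1 lasts by (auto simp: reduced_append)
      have 3: "reduced (winv x2 @ winv y2)"
        using q(3) reduced_winv[of "y2 @ x2"] by simp
      have 4: "reduced (winv y2 @ x1)"
        using left red x1 y2 lasts by (auto simp: reduced_append)
      show "reduced (w @ w)" unfolding w_def append_assoc
        using p(3) 2 3 4 x1 x2 y1 y2 by (intro ov) auto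
      show "x1 @ y1 @ winv x2 @ winv y2 = x1 \<bullet> (y1 \<bullet> (winv x2 \<bullet> winv y2))"
        using p(3) 2 3 y1 x2 ov by (metis fmult_eq_append winv_simps(6))
    qed
    moreover have "comm x y = x1 \<bullet> (y1 \<bullet> (winv x2 \<bullet> winv y2))"
    proof -
      have "comm x y = (x1 \<bullet> p) \<bullet> (finv p \<bullet> y1) \<bullet> finv (finv q \<bullet> x2) \<bullet> finv (y2 \<bullet> q)"
        using p(1,2) q(1,2) x(1) y(1) red unfolding comm_def
        by (metis fmult_eq_append finv_eq)
      then show ?thesis
        using red by (simp add: free_simps flip: finv_eq carrier_free_group)
    qed
    ultimately have "length w \<le> 4" using bound[OF _ ww] by (simp add: w_def)
    moreover have len: "length x1 + length p = length x" "length x2 + length q = length x"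
      "length y1 + length p = length y" "length y2 + length q = length y"
      using arg_cong[OF p(1), of length] arg_cong[OF p(2), of length]
        arg_cong[OF q(1), of length] arg_cong[OF q(2), of length] by simp_all
    \<comment> \<open>Each of \<open>p\<close> and \<open>q\<close> is missing from two factors of
      \<open>w\<close>, so the bound 4 can be halved.\<close>
    ultimately have sum: "length x + length y \<le> 2 + length p + length q"
      by (simp add: w_def)
    have "length x > 0" using x by simp
    show ?thesis
    proof (cases "length x = 1")
      case True
      then have "length p = 0" "length q = 0" using lp lq by linarith+
      then show ?thesis using True sum le by simp
    next
      case False
      \<comment> \<open>The only lengths left besides the desired ones. Here \<open>y\<close> is the
        inverse of \<open>x\<close>, which contradicts the nontrivial commutator.\<close>
      then have l: "length x = 2" "length y = 2" "length p = 1" "length q = 1"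
        using sum lp lq le \<open>length x > 0\<close> by linarith+
      then have "x1 = winv q" "y1 = q"
        using p(1,2) q(1,2) len
        by (metis append_eq_append_conv winv_simps(5) add_diff_cancel_right' diff_Suc_1 one_add_one)+
      then have "y = winv x" using p by simp
      then have "y = finv x" "x \<in> carrier free_group"
        using x(1) by (simp_all add: finv_eq carrier_free_group)
      then have "comm x y = \<one>\<^bsub>free_group\<^esub>"
        by (simp add: comm_def)
      then show ?thesis using ne by (simp add: one_free_group)
    qed
  qed
qed

text \<open>If \<open>x\<close> and \<open>y\<close> start with the same letter,
  \<open>finv x\<close> takes the role of \<open>x\<close>: cyclic reducedness gives it another
  first letter, the minimality conditions are permuted, and the commutator becomes a conjugate of
  the inverse one.\<close>

lemma commutator_letters:
  assumes x: "reduced x" "x \<noteq> []" "reduced (x @ x)" and y: "reduced y" "y \<noteq> []"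
    and le: "length x \<le> length y"
    and min: "length y \<le> length (x \<bullet> y)" "length y \<le> length (y \<bullet> x)"
      "length y \<le> length (y \<bullet> finv x)" "length y \<le> length (finv x \<bullet> y)"
    and ne: "comm x y \<noteq> []"
    and k: "reduced k" "length (k \<bullet> comm x y \<bullet> finv k) \<le> 4"
  shows "length x = 1 \<and> length y = 1"
proof (cases "hd y = hd x")
  case False
  then show ?thesis
    using commutator_letters_aux[OF x y le min(1,2,3) _ ne k] by blast
next
  case True
  have car: "x \<in> carrier free_group" "y \<in> carrier free_group" "k \<in> carrier free_group"
    using x y k by (simp_all add: carrier_free_group)
  have comm_inv: "comm (finv x) y = finv x \<bullet> finv (comm x y) \<bullet> x"
    using car by (simp add: comm_def free_simps)
  have ne': "comm (finv x) y \<noteq> []"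
  proof
    assume "comm (finv x) y = []"
    moreover have "comm x y = x \<bullet> finv (comm (finv x) y) \<bullet> finv x"
      using car unfolding comm_inv by (simp add: free_simps)
    ultimately show False using ne car by (simp flip: one_free_group)
  qed
  have kx: "(k \<bullet> x) \<bullet> comm (finv x) y \<bullet> finv (k \<bullet> x) = finv (k \<bullet> comm x y \<bullet> finv k)"
    using car unfolding comm_inv by (simp add: free_simps)
  have "reduced (k \<bullet> comm x y \<bullet> finv k)" "reduced (k \<bullet> x)"
    using car by (simp_all flip: carrier_free_group)
  then have "length ((k \<bullet> x) \<bullet> comm (finv x) y \<bullet> finv (k \<bullet> x)) \<le> 4"
    using k unfolding kx by simp
  moreover have "hd y \<noteq> hd (finv x)"
    using True x by (simp add: finv_eq reduced_append)
  moreover have "reduced (finv x @ finv x)"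
    using x(3) reduced_winv[of "x @ x"] x(1) by (simp add: finv_eq)
  moreover have "finv x \<noteq> []" "reduced (finv x)" using x by (simp_all add: finv_eq)
  ultimately have "length (finv x) = 1 \<and> length y = 1"
    using commutator_letters_aux[of "finv x" y "k \<bullet> x"] x(1) y le min ne' car
      \<open>reduced (k \<bullet> x)\<close> by simp
  then show ?thesis using x by simp
qed

section \<open>The orientation of the commutator\<close>

text \<open>\<open>F2\<close> acts on \<open>\<int>\<^sup>3\<close> through the integral Heisenberg group. The commutator of the
  generators acts as a central element of infinite order, so it is not conjugate to its inverse.\<close>

fun heis :: "gen letter \<Rightarrow> int \<times> int \<times> int \<Rightarrow> int \<times> int \<times> int" where
  "heis (GenA, pos) (i, j, k) = (i + (if pos then 1 else - 1), j, k)"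
| "heis (GenB, pos) (i, j, k) =
     (i, j + (if pos then 1 else - 1), k + (if pos then i else - i))"

definition shift :: "int \<times> int \<times> int \<Rightarrow> int \<times> int \<times> int" where
  "shift t = (case t of (i, j, k) \<Rightarrow> (i, j, k - 1))"

lemma heis_inv_letter: "heis l (heis (inv_letter l) t) = t"
  by (cases "(l, t)" rule: heis.cases) (auto simp: inv_letter_def)

lemma heis_shift: "heis l (shift t) = shift (heis l t)"
  by (cases "(l, t)" rule: heis.cases) (auto simp: shift_def)

lemma foldr_heis_shift: "foldr heis w (shift t) = shift (foldr heis w t)"
  by (induction w) (simp_all add: heis_shift)

text \<open>Inverse letters act inversely, so free reduction does not change the action.\<close>

lemma foldr_heis_mult: "foldr heis (u \<bullet> v) t = foldr heis u (foldr heis v t)"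
proof -
  have "foldr heis (red_cons l w) t = heis l (foldr heis w t)" for l w
    by (cases w) (auto simp: heis_inv_letter)
  then show ?thesis unfolding fmult_eq by (induction u) simp_all
qed

abbreviation comm_ab :: "gen letter list" where
  "comm_ab \<equiv> comm gen_a gen_b"

lemma comm_ab_eq: "comm_ab = [(GenA, True), (GenB, True), (GenA, False), (GenB, False)]"
  by (simp only: comm_def inv_free_gen) (simp add: free_gen_def fmult_eq inv_letter_def)

lemma reduced_comm_ab [simp]: "reduced comm_ab"
  by (simp add: comm_ab_eq inv_letter_def)

text \<open>The commutator itself acts as \<open>shift\<close>, which commutes with every letter, so
  conjugation has no effect.\<close>

lemma foldr_heis_conj_comm_ab:
  assumes "k \<in> carrier F2"
  shows "foldr heis (k \<bullet> comm_ab \<bullet> finv k) t = shift t"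
proof -
  have "foldr heis comm_ab t = shift t" for t
    by (cases t) (simp add: comm_ab_eq shift_def)
  then have "foldr heis (k \<bullet> comm_ab \<bullet> finv k) t = shift (foldr heis (k \<bullet> finv k) t)"
    by (simp add: foldr_heis_mult foldr_heis_shift)
  then show ?thesis using assms by (simp add: one_free_group)
qed

section \<open>Images of the basis under the automorphisms\<close>

lemma R_aut_carrier: "w \<in> carrier F2 \<Longrightarrow> R_aut w \<in> carrier (AutoGroup F2)"
  using R_aut_hom by (rule hom_in_carrier)

lemma R_aut_mult:
  assumes "w \<in> carrier F2" "x \<in> carrier F2" "y \<in> carrier F2"
  shows "R_aut w (x \<bullet> y) = R_aut w x \<bullet> R_aut w y"
  using R_aut_carrier[OF assms(1)] assms by (simp add: AutoGroup_def auto_def hom_def)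

lemma R_aut_closed [simp]:
  "w \<in> carrier F2 \<Longrightarrow> x \<in> carrier F2 \<Longrightarrow> R_aut w x \<in> carrier F2"
  using R_aut_carrier[of w] by (auto simp: AutoGroup_def auto_def hom_def)

lemma R_aut_inv:
  assumes "w \<in> carrier F2" "x \<in> carrier F2"
  shows "R_aut w (finv x) = finv (R_aut w x)"
proof -
  have "R_aut w \<in> hom F2 F2"
    using R_aut_carrier[OF assms(1)] by (simp add: AutoGroup_def auto_def)
  then show ?thesis
    using assms by (intro group_hom.hom_inv)
      (auto intro: group_hom.intro group_hom_axioms.intro F2.group_axioms)
qed

lemma R_aut_comp:
  assumes "w \<in> carrier F2" "v \<in> carrier F2" "x \<in> carrier F2"
  shows "R_aut (w \<bullet> v) x = R_aut w (R_aut v x)"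
proof -
  have "R_aut (w \<bullet> v) = R_aut w \<otimes>\<^bsub>AutoGroup F2\<^esub> R_aut v"
    using R_aut_hom assms by (simp add: hom_mult)
  then show ?thesis
    using R_aut_carrier[of w] R_aut_carrier[of v] assms
    by (simp add: AutoGroup_def BijGroup_def auto_def compose_def)
qed

lemma R_aut_one: "x \<in> carrier F2 \<Longrightarrow> R_aut \<one>\<^bsub>F2\<^esub> x = x"
  using hom_one[OF R_aut_hom F2.group_axioms F2.AutoGroup]
  by (simp add: AutoGroup_def BijGroup_def)

text \<open>A calculation for the two generators, which passes to their inverses and then, letter by
  letter, to all words.\<close>

lemma R_aut_comm_ab:
  assumes "w \<in> carrier F2" shows "R_aut w comm_ab = comm_ab"
proof -
  have gen: "R_aut (free_gen x) comm_ab = comm_ab" for x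
    by (cases x) (simp_all add: comm_def R_aut_mult R_aut_inv R_aut_values free_simps)
  have letter: "R_aut [l] comm_ab = comm_ab" for l
  proof (cases l)
    case (Pair x pos)
    have "R_aut (finv (free_gen x)) comm_ab = R_aut (finv (free_gen x)) (R_aut (free_gen x) comm_ab)"
      by (simp only: gen)
    also have "\<dots> = R_aut (finv (free_gen x) \<bullet> free_gen x) comm_ab"
      by (rule R_aut_comp[symmetric]) simp_all
    also have "\<dots> = comm_ab"
      by (simp add: R_aut_one)
    finally show ?thesis
      using gen[of x] Pair by (cases pos) (simp_all flip: inv_free_gen free_gen_def)
  qed
  have "reduced w" using assms by (simp add: carrier_free_group)
  then show ?thesis
  proof (induction w)
    case Nil
    then show ?case using R_aut_one[of comm_ab] by (simp add: one_free_group)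
  next
    case (Cons l w)
    then have "R_aut (l # w) comm_ab = R_aut ([l] \<bullet> w) comm_ab"
      by (simp add: fmult_eq red_cons_reduced)
    also have "\<dots> = R_aut [l] (R_aut w comm_ab)"
      using Cons.prems by (intro R_aut_comp) (auto simp: carrier_free_group reduced_Cons)
    also have "\<dots> = comm_ab"
      using Cons letter by (simp add: reduced_Cons)
    finally show ?case .
  qed
qed

text \<open>These pairs turn out in \<open>R_pair_iff_comm\<close> to be exactly the solutions of
  \<open>comm x y = comm_ab\<close>.\<close>

definition R_pair :: "gen letter list \<Rightarrow> gen letter list \<Rightarrow> bool" where
  "R_pair x y \<longleftrightarrow> (\<exists>w\<in>carrier F2. x = R_aut w gen_a \<and> y = R_aut w gen_b)"

lemma R_pair_closed: "R_pair x y \<Longrightarrow> x \<in> carrier F2 \<and> y \<in> carrier F2"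
  by (auto simp: R_pair_def)

text \<open>Replace \<open>w\<close> by \<open>w \<bullet> v\<close> with \<open>v\<close> a
  generator or its inverse: \<open>R_aut w\<close> is applied to the values of
  \<open>R_aut v\<close> on the basis.\<close>

lemma R_pair_mult:
  assumes "R_pair x y"
  shows "R_pair x (y \<bullet> x)" "R_pair x (y \<bullet> finv x)" "R_pair (x \<bullet> y) y" "R_pair (x \<bullet> finv y) y"
proof -
  obtain w where w: "w \<in> carrier F2" "x = R_aut w gen_a" "y = R_aut w gen_b"
    using assms by (auto simp: R_pair_def)
  have inv_a: "R_aut (finv gen_a) gen_a = gen_a" "R_aut (finv gen_a) gen_b = gen_b \<bullet> finv gen_a"
  proof -
    have 1: "R_aut (finv gen_a) (R_aut gen_a z) = z" if "z \<in> carrier F2" for z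
      using that by (simp add: R_aut_one flip: R_aut_comp)
    show "R_aut (finv gen_a) gen_a = gen_a"
      using 1[of gen_a] by (simp add: R_aut_values)
    \<comment> \<open>The argument \<open>gen_b \<bullet> finv gen_a\<close> is the preimage of
      \<open>gen_b\<close> under \<open>R_aut gen_a\<close>.\<close>
    show "R_aut (finv gen_a) gen_b = gen_b \<bullet> finv gen_a"
      using 1[of "gen_b \<bullet> finv gen_a"]
      by (simp add: R_aut_values R_aut_mult R_aut_inv free_simps)
  qed
  have inv_b: "R_aut (finv gen_b) gen_b = gen_b" "R_aut (finv gen_b) gen_a = gen_a \<bullet> finv gen_b"
  proof -
    have 1: "R_aut (finv gen_b) (R_aut gen_b z) = z" if "z \<in> carrier F2" for z
      using that by (simp add: R_aut_one flip: R_aut_comp)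
    show "R_aut (finv gen_b) gen_b = gen_b"
      using 1[of gen_b] by (simp add: R_aut_values)
    show "R_aut (finv gen_b) gen_a = gen_a \<bullet> finv gen_b"
      using 1[of "gen_a \<bullet> finv gen_b"]
      by (simp add: R_aut_values R_aut_mult R_aut_inv free_simps)
  qed
  have "R_pair (R_aut w (R_aut v gen_a)) (R_aut w (R_aut v gen_b))" if "v \<in> carrier F2" for v
    unfolding R_pair_def using that w(1)
    by (intro bexI[of _ "w \<bullet> v"]) (simp_all add: R_aut_comp)
  from this[of gen_a] this[of gen_b] this[of "finv gen_a"] this[of "finv gen_b"]
  show "R_pair x (y \<bullet> x)" "R_pair x (y \<bullet> finv x)" "R_pair (x \<bullet> y) y" "R_pair (x \<bullet> finv y) y"
    using w by (simp_all add: R_aut_values inv_a inv_b R_aut_mult R_aut_inv)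
qed

text \<open>Three elementary moves compose to a quarter turn: on the abelianization
  \<open>(x, y)\<close> goes to \<open>(-y, x)\<close> and to \<open>(y, -x)\<close>.\<close>

lemma R_pair_rotate:
  assumes "R_pair x y"
  shows "R_pair (finv y) (y \<bullet> x \<bullet> finv y)" "R_pair (x \<bullet> y \<bullet> finv x) (finv x)"
proof -
  have car: "x \<in> carrier F2" "y \<in> carrier F2" using R_pair_closed[OF assms] by auto
  from R_pair_mult(1)[OF R_pair_mult(4)[OF R_pair_mult(1)[OF assms]]]
  show "R_pair (finv y) (y \<bullet> x \<bullet> finv y)"
    using car by (simp add: free_simps)
  from R_pair_mult(2)[OF R_pair_mult(3)[OF R_pair_mult(2)[OF assms]]]
  show "R_pair (x \<bullet> y \<bullet> finv x) (finv x)"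
    using car by (simp add: free_simps)
qed

text \<open>The fourth power of a rotation of pairs is conjugation by the commutator.\<close>

lemma R_pair_conj_comm:
  assumes "R_pair x y"
  shows "R_pair (comm x y \<bullet> x \<bullet> finv (comm x y)) (comm x y \<bullet> y \<bullet> finv (comm x y))"
    and "R_pair (finv (comm x y) \<bullet> x \<bullet> comm x y) (finv (comm x y) \<bullet> y \<bullet> comm x y)"
proof -
  have car: "x \<in> carrier F2" "y \<in> carrier F2" using R_pair_closed[OF assms] by auto
  from R_pair_rotate(2)[OF R_pair_rotate(2)[OF R_pair_rotate(2)[OF R_pair_rotate(2)[OF assms]]]]
  show "R_pair (comm x y \<bullet> x \<bullet> finv (comm x y)) (comm x y \<bullet> y \<bullet> finv (comm x y))"
    using car by (simp add: free_simps comm_def)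
  from R_pair_rotate(1)[OF R_pair_rotate(1)[OF R_pair_rotate(1)[OF R_pair_rotate(1)[OF assms]]]]
  show "R_pair (finv (comm x y) \<bullet> x \<bullet> comm x y) (finv (comm x y) \<bullet> y \<bullet> comm x y)"
    using car by (simp add: free_simps comm_def)
qed

lemma R_pair_comm:
  assumes "R_pair x y" shows "comm x y = comm_ab"
proof -
  obtain w where w: "w \<in> carrier F2" "x = R_aut w gen_a" "y = R_aut w gen_b"
    using assms by (auto simp: R_pair_def)
  then have "comm x y = R_aut w comm_ab"
    by (simp add: comm_def R_aut_mult R_aut_inv)
  then show ?thesis using w by (simp add: R_aut_comm_ab)
qed

text \<open>Induction in both directions from 0: each conjugated pair is again an
  \<open>R_pair\<close>, so its commutator is still \<open>comm_ab\<close> and the same element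
  serves for the next conjugation.\<close>

lemma R_pair_conj_pow:
  assumes "R_pair x y"
  shows "R_pair (comm_ab [^]\<^bsub>F2\<^esub> (n::int) \<bullet> x \<bullet> finv (comm_ab [^]\<^bsub>F2\<^esub> n))
    (comm_ab [^]\<^bsub>F2\<^esub> n \<bullet> y \<bullet> finv (comm_ab [^]\<^bsub>F2\<^esub> n))"
proof -
  have car: "x \<in> carrier F2" "y \<in> carrier F2" "comm_ab \<in> carrier F2"
    using R_pair_closed[OF assms] by auto
  show ?thesis
  proof (induction n rule: int_induct[of _ 0])
    case base
    then show ?case using assms car by simp
  next
    case (step1 n)
    have "comm_ab [^]\<^bsub>F2\<^esub> (n + 1) = comm_ab \<bullet> comm_ab [^]\<^bsub>F2\<^esub> n"
      using car by (metis F2.int_pow_mult F2.int_pow_1 add.commute)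
    then show ?case
      using R_pair_conj_comm(1)[OF step1(2)] R_pair_comm[OF step1(2)] car
      by (simp add: free_simps)
  next
    case (step2 n)
    have "comm_ab [^]\<^bsub>F2\<^esub> (n - 1) = finv comm_ab \<bullet> comm_ab [^]\<^bsub>F2\<^esub> n"
      using car F2.int_pow_mult[of comm_ab "-1" n] by (simp add: F2.int_pow_neg F2.int_pow_1)
    then show ?case
      using R_pair_conj_comm(2)[OF step2(2)] R_pair_comm[OF step2(2)] car
      by (simp add: free_simps)
  qed
qed

section \<open>The centralizer of the commutator\<close>

text \<open>Induction on the length of \<open>k\<close>. Either a power of the commutator shortens
  \<open>k\<close>, or after at most two letters of \<open>k\<close> no cancellation is left, and a
  cyclic rotation of the commutator would have to equal it.\<close>

lemma centralizer_comm_ab: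
  assumes "k \<in> carrier F2" "finv k \<bullet> comm_ab \<bullet> k = comm_ab"
  shows "\<exists>n::int. k = comm_ab [^]\<^bsub>F2\<^esub> n"
  using assms
proof (induction k rule: length_induct)
  case (1 k)
  let ?c = "comm_ab"
  let ?a = "(GenA, True)" and ?b = "(GenB, True)" and ?a' = "(GenA, False)" and ?b' = "(GenB, False)"
  have red: "reduced k" and car: "k \<in> carrier F2" "?c \<in> carrier F2"
    and comm: "finv k \<bullet> ?c \<bullet> k = ?c"
    using 1 by (simp_all add: carrier_free_group)
  \<comment> \<open>Without cancellation the conjugate has \<open>4 + 2 * length v\<close> letters,
    but \<open>?c\<close> has 4.\<close>
  have no_cancel: "v = [] \<and> w = ?c"
    if "reduced v" "reduced w" "length w = 4" "finv v \<bullet> w \<bullet> v = ?c"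
      "v \<noteq> [] \<Longrightarrow> hd v \<noteq> inv_letter (last w) \<and> hd v \<noteq> hd w" for v w
  proof -
    have w: "w \<noteq> []" using that(3) by auto
    have 1: "reduced (winv v @ w)" "reduced (w @ v)"
      using that w by (auto simp: reduced_append)
    then have 2: "reduced ((winv v @ w) @ v)"
      using reduced_append_overlap[OF 1(1) w 1(2)] by simp
    have "?c = winv v @ w @ v"
      using fmult_eq_append[OF 1(1)] fmult_eq_append[OF 2] that(1,4) by (simp add: finv_eq)
    moreover have "v = []"
      using arg_cong[OF calculation, of length] that(3) by (simp add: comm_ab_eq)
    ultimately show ?thesis by simp
  qed
  have conj: "finv v \<bullet> (finv u \<bullet> ?c \<bullet> u) \<bullet> v = ?c" if "k = u @ v" for u v
  proof -
    have "u \<in> carrier F2" "v \<in> carrier F2" "k = u \<bullet> v"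
      using that red fmult_eq_append[of u v] by (simp_all add: carrier_free_group reduced_append)
    then show ?thesis using comm car by (simp add: free_simps)
  qed
  \<comment> \<open>Multiplication by a power of \<open>?c\<close> keeps \<open>k\<close> in the
    centralizer, so the induction hypothesis applies to the shorter product.\<close>
  have step: ?case if shorter: "length (?c [^]\<^bsub>F2\<^esub> m \<bullet> k) < length k" for m :: int
  proof -
    let ?k = "?c [^]\<^bsub>F2\<^esub> m \<bullet> k"
    have "?c \<bullet> ?c [^]\<^bsub>F2\<^esub> m = ?c [^]\<^bsub>F2\<^esub> m \<bullet> ?c"
      using car F2.int_pow_mult[of ?c 1 m] F2.int_pow_mult[of ?c m 1]
      by (simp add: F2.int_pow_1 add.commute)
    then have "finv (?c [^]\<^bsub>F2\<^esub> m) \<bullet> ?c \<bullet> ?c [^]\<^bsub>F2\<^esub> m = ?c"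
      using car by (simp add: free_simps)
    moreover have "finv ?k \<bullet> ?c \<bullet> ?k
        = finv k \<bullet> (finv (?c [^]\<^bsub>F2\<^esub> m) \<bullet> ?c \<bullet> ?c [^]\<^bsub>F2\<^esub> m) \<bullet> k"
      using car by (simp add: free_simps)
    ultimately have "finv ?k \<bullet> ?c \<bullet> ?k = ?c"
      using comm by (simp only:)
    then obtain n :: int where n: "?k = ?c [^]\<^bsub>F2\<^esub> n"
      using 1(1)[rule_format, of ?k] shorter car by auto
    have "k = finv (?c [^]\<^bsub>F2\<^esub> m) \<bullet> ?k"
      using car by (simp add: free_simps)
    then have "k = finv (?c [^]\<^bsub>F2\<^esub> m) \<bullet> ?c [^]\<^bsub>F2\<^esub> n"
      by (simp only: n)
    then have "k = ?c [^]\<^bsub>F2\<^esub> (- m + n)"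
      using car F2.int_pow_mult[of ?c "- m" n] by (simp add: F2.int_pow_neg)
    then show ?thesis by blast
  qed
  have inv1: "finv [l] = [inv_letter l]" for l :: "gen letter"
    by (simp add: finv_eq)
  have inv2: "finv [l, m] = [inv_letter m, inv_letter l]" if "m \<noteq> inv_letter l" for l m :: "gen letter"
    using that by (simp add: finv_eq)
  \<comment> \<open>The cases record how far \<open>k\<close> follows \<open>finv ?c\<close>
    (starting with \<open>?b\<close>) or \<open>?c\<close> (starting with \<open>?a\<close>). After
    three common letters, \<open>?c\<close> or its inverse respectively shortens
    \<open>k\<close>.\<close>
  consider "k = []" | "k \<noteq> []" "hd k \<noteq> ?a" "hd k \<noteq> ?b"
    | k1 where "k = ?b # k1" "k1 = [] \<or> hd k1 \<noteq> ?a"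
    | k2 where "k = ?b # ?a # k2" "k2 = [] \<or> hd k2 \<noteq> ?b'"
    | k3 where "k = ?b # ?a # ?b' # k3"
    | k1 where "k = ?a # k1" "k1 = [] \<or> hd k1 \<noteq> ?b"
    | k2 where "k = ?a # ?b # k2" "k2 = [] \<or> hd k2 \<noteq> ?a'"
    | k3 where "k = ?a # ?b # ?a' # k3"
  proof (cases k)
    case (Cons l k1)
    note k = this
    show thesis
    proof (cases "l = ?a \<or> l = ?b")
      case False
      then show ?thesis using that(2) k by auto
    next
      case l: True
      show ?thesis
      proof (cases k1)
        case Nil
        then show ?thesis using that(3,6) l k by blast
      next
        case (Cons m k2)
        then show ?thesis
          using that(3-8) l k by (cases k2; cases "hd k2") auto
      qed
    qed
  qed (rule that(1))
  then show ?case
  proof cases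
    case 1
    then show ?thesis by (intro exI[of _ 0]) (simp add: one_free_group)
  next
    case 2
    have "k = []"
      using no_cancel[of k ?c] 2 red comm by (simp add: comm_ab_eq inv_letter_def)
    then show ?thesis using 2 by simp
  next
    case (3 k1)
    have "finv [?b] \<bullet> ?c \<bullet> [?b] = [?b', ?a, ?b, ?a']"
      by (simp add: inv1 comm_ab_eq fmult_eq inv_letter_def)
    then have "[?b', ?a, ?b, ?a'] = ?c"
      using no_cancel[of k1 "[?b', ?a, ?b, ?a']"] conj[of "[?b]" k1] 3 red
      by (auto simp: inv_letter_def reduced_Cons)
    then show ?thesis by (simp add: comm_ab_eq)
  next
    case (4 k2)
    have "finv [?b, ?a] \<bullet> ?c \<bullet> [?b, ?a] = [?a', ?b', ?a, ?b]"
      by (simp add: inv2 comm_ab_eq fmult_eq inv_letter_def)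
    then have "[?a', ?b', ?a, ?b] = ?c"
      using no_cancel[of k2 "[?a', ?b', ?a, ?b]"] conj[of "[?b, ?a]" k2] 4 red
      by (auto simp: inv_letter_def reduced_Cons)
    then show ?thesis by (simp add: comm_ab_eq)
  next
    case (5 k3)
    have "reduced k3" using 5 red by (auto simp: reduced_Cons)
    then have "?c \<bullet> k = red_cons ?a k3"
      using red by (simp add: 5 comm_ab_eq fmult_eq inv_letter_def)
    moreover have "length (red_cons ?a k3) \<le> Suc (length k3)" by (cases k3) auto
    ultimately show ?thesis using step[of 1] car by (simp add: 5 F2.int_pow_1)
  next
    case (6 k1)
    have "finv [?a] \<bullet> ?c \<bullet> [?a] = [?b, ?a', ?b', ?a]"
      by (simp add: inv1 comm_ab_eq fmult_eq inv_letter_def)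
    then have "[?b, ?a', ?b', ?a] = ?c"
      using no_cancel[of k1 "[?b, ?a', ?b', ?a]"] conj[of "[?a]" k1] 6 red
      by (auto simp: inv_letter_def reduced_Cons)
    then show ?thesis by (simp add: comm_ab_eq)
  next
    case (7 k2)
    have "finv [?a, ?b] \<bullet> ?c \<bullet> [?a, ?b] = [?a', ?b', ?a, ?b]"
      by (simp add: inv2 comm_ab_eq fmult_eq inv_letter_def)
    then have "[?a', ?b', ?a, ?b] = ?c"
      using no_cancel[of k2 "[?a', ?b', ?a, ?b]"] conj[of "[?a, ?b]" k2] 7 red
      by (auto simp: inv_letter_def reduced_Cons)
    then show ?thesis by (simp add: comm_ab_eq)
  next
    case (8 k3)
    have "finv ?c = [?b, ?a, ?b', ?a']"
      using finv_eq[OF reduced_comm_ab] by (simp add: comm_ab_eq inv_letter_def)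
    then have "finv ?c \<bullet> k = red_cons ?b k3"
      by (simp add: 8 fmult_eq inv_letter_def)
    moreover have "length (red_cons ?b k3) \<le> Suc (length k3)" by (cases k3) auto
    ultimately show ?thesis
      using step[of "- 1"] car by (simp add: 8 F2.int_pow_neg F2.int_pow_1)
  qed
qed

section \<open>Nielsen reduction\<close>

definition R_pair_conj :: "gen letter list \<Rightarrow> gen letter list \<Rightarrow> bool" where
  "R_pair_conj x y \<longleftrightarrow> (\<exists>k\<in>carrier F2. R_pair (k \<bullet> x \<bullet> finv k) (k \<bullet> y \<bullet> finv k))"

context
  fixes x y :: "gen letter list"
  assumes car: "x \<in> carrier F2" "y \<in> carrier F2"
begin

lemma R_pair_conjI_conj:
  assumes "R_pair_conj (k \<bullet> x \<bullet> finv k) (k \<bullet> y \<bullet> finv k)" "k \<in> carrier F2"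
  shows "R_pair_conj x y"
proof -
  obtain j where j: "j \<in> carrier F2"
    "R_pair (j \<bullet> (k \<bullet> x \<bullet> finv k) \<bullet> finv j) (j \<bullet> (k \<bullet> y \<bullet> finv k) \<bullet> finv j)"
    using assms by (auto simp: R_pair_conj_def)
  then show ?thesis
    using assms(2) car unfolding R_pair_conj_def
    by (intro bexI[of _ "j \<bullet> k"]) (simp_all add: free_simps)
qed

lemma R_pair_conjI_mult_right:
  assumes "R_pair_conj x (y \<bullet> x)" shows "R_pair_conj x y"
proof -
  obtain k where k: "k \<in> carrier F2" "R_pair (k \<bullet> x \<bullet> finv k) (k \<bullet> (y \<bullet> x) \<bullet> finv k)"
    using assms by (auto simp: R_pair_conj_def)
  show ?thesis
    using R_pair_mult(2)[OF k(2)] k(1) car unfolding R_pair_conj_def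
    by (intro bexI[of _ k]) (simp_all add: free_simps)
qed

lemma R_pair_conjI_mult_inv_right:
  assumes "R_pair_conj x (y \<bullet> finv x)" shows "R_pair_conj x y"
proof -
  obtain k where k: "k \<in> carrier F2" "R_pair (k \<bullet> x \<bullet> finv k) (k \<bullet> (y \<bullet> finv x) \<bullet> finv k)"
    using assms by (auto simp: R_pair_conj_def)
  show ?thesis
    using R_pair_mult(1)[OF k(2)] k(1) car unfolding R_pair_conj_def
    by (intro bexI[of _ k]) (simp_all add: free_simps)
qed

lemma R_pair_conjI_rotate:
  assumes "R_pair_conj y (finv x)" shows "R_pair_conj x y"
proof -
  obtain k where k: "k \<in> carrier F2" "R_pair (k \<bullet> y \<bullet> finv k) (k \<bullet> finv x \<bullet> finv k)"
    using assms by (auto simp: R_pair_conj_def)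
  show ?thesis
    \<comment> \<open>Rotating \<open>(y, finv x)\<close> gives
      \<open>(x, finv x \<bullet> y \<bullet> x)\<close>, the conjugate of \<open>(x, y)\<close> by
      \<open>finv x\<close>.\<close>
    using R_pair_rotate(1)[OF k(2)] k(1) car unfolding R_pair_conj_def
    by (intro bexI[of _ "k \<bullet> finv x"]) (simp_all add: free_simps)
qed

end

text \<open>Conjugation by \<open>x\<close> fixes \<open>x\<close> and turns
  \<open>y \<bullet> x\<close> into \<open>x \<bullet> y\<close>.\<close>

lemma R_pair_conjI_mult_left:
  assumes "x \<in> carrier F2" "y \<in> carrier F2" "R_pair_conj x (x \<bullet> y)"
  shows "R_pair_conj x y"
proof (rule R_pair_conjI_mult_right[OF assms(1,2)])
  show "R_pair_conj x (y \<bullet> x)"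
    by (rule R_pair_conjI_conj[where k = x]) (use assms in \<open>simp_all add: free_simps\<close>)
qed

lemma R_pair_conjI_mult_inv_left:
  assumes "x \<in> carrier F2" "y \<in> carrier F2" "R_pair_conj x (finv x \<bullet> y)"
  shows "R_pair_conj x y"
proof (rule R_pair_conjI_mult_inv_right[OF assms(1,2)])
  show "R_pair_conj x (y \<bullet> finv x)"
    by (rule R_pair_conjI_conj[where k = "finv x"]) (use assms in \<open>simp_all add: free_simps\<close>)
qed

text \<open>The Heisenberg action leaves only the four pairs of letters with the right orientation,
  and these form one orbit of the rotation, starting from the basis.\<close>

lemma R_pair_conj_letters:
  assumes "comm [l] [m] = k \<bullet> comm_ab \<bullet> finv k" "k \<in> carrier F2"
  shows "R_pair_conj [l] [m]"
proof -
  let ?a = "(GenA, True)" and ?b = "(GenB, True)" and ?a' = "(GenA, False)" and ?b' = "(GenB, False)"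
  have inv: "finv [l] = [inv_letter l]" for l :: "gen letter" by (simp add: finv_eq)
  have car: "[l] \<in> carrier F2" for l :: "gen letter" by (simp add: carrier_free_group)
  have "foldr heis (comm [l] [m]) (0, 0, 0) = (0, 0, -1)"
    unfolding assms(1) foldr_heis_conj_comm_ab[OF assms(2)] by (simp add: shift_def)
  then have cases: "(l, m) \<in> {(?a, ?b), (?b, ?a'), (?a', ?b'), (?b', ?a)}"
    unfolding comm_def inv
    by (cases "(l, (0::int, 0::int, 0::int))" rule: heis.cases;
        cases "(m, (0::int, 0::int, 0::int))" rule: heis.cases)
      (auto simp: foldr_heis_mult inv_letter_def split: if_splits)
  have "R_pair gen_a gen_b"
    unfolding R_pair_def by (intro bexI[of _ "\<one>\<^bsub>F2\<^esub>"]) (simp_all add: R_aut_one)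
  then have 1: "R_pair_conj [?a] [?b]"
    unfolding R_pair_conj_def by (intro bexI[of _ "\<one>\<^bsub>F2\<^esub>"]) (simp_all flip: free_gen_def)
  have 2: "R_pair_conj [?b'] [?a]"
    using R_pair_conjI_rotate[of "[?b']" "[?a]"] 1 by (simp add: car inv inv_letter_def)
  have 3: "R_pair_conj [?a'] [?b']"
    using R_pair_conjI_rotate[of "[?a']" "[?b']"] 2 by (simp add: car inv inv_letter_def)
  have 4: "R_pair_conj [?b] [?a']"
    using R_pair_conjI_rotate[of "[?b]" "[?a']"] 3 by (simp add: car inv inv_letter_def)
  show ?thesis using cases 1 2 3 4 by auto
qed

text \<open>Nielsen descent: conjugate \<open>x\<close> to a cyclically reduced word, rotate the
  pair if \<open>y\<close> is shorter than \<open>x\<close>, then multiply \<open>y\<close> by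
  \<open>x\<close> or its inverse on either side. When nothing shortens,
  \<open>commutator_letters\<close> leaves two letters.\<close>

lemma R_pair_conj_if_comm_conj:
  assumes "x \<in> carrier F2" "y \<in> carrier F2" "k \<in> carrier F2"
    and "comm x y = k \<bullet> comm_ab \<bullet> finv k"
  shows "R_pair_conj x y"
  using assms
  \<comment> \<open>The weight 2 makes the measure drop when conjugation by a letter shortens \<open>x\<close> by two letters
    and lengthens \<open>y\<close> by at most two.\<close>
proof (induction "2 * length x + length y" arbitrary: x y k rule: less_induct)
  case less
  note car = less.prems(1-3) and comm = less.prems(4)
  have red: "reduced x" "reduced y" "reduced k"
    using car by (simp_all add: carrier_free_group)
  \<comment> \<open>A conjugate of \<open>comm_ab\<close> acts as \<open>shift\<close>, which moves
    the origin, unlike the empty word.\<close>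
  have ne: "comm x y \<noteq> []"
  proof
    assume "comm x y = []"
    then have "shift (0, 0, 0) = (0, 0, 0)"
      using foldr_heis_conj_comm_ab[OF car(3), of "(0, 0, 0)"] comm by simp
    then show False by (simp add: shift_def)
  qed
  then have x: "x \<noteq> []" and y: "y \<noteq> []"
    using car by (auto simp: comm_def free_simps simp flip: one_free_group)
  have shorter: "R_pair_conj x z"
    if "z \<in> {x \<bullet> y, y \<bullet> x, y \<bullet> finv x, finv x \<bullet> y}" "length z < length y" for z
  proof -
    \<comment> \<open>Multiplying \<open>y\<close> on the right leaves the commutator unchanged;
      multiplying it on the left conjugates it by the factor.\<close>
    have "\<exists>j\<in>carrier F2. comm x z = j \<bullet> comm x y \<bullet> finv j"
      using that(1)
    proof (elim insertE emptyE)
      show ?thesis if "z = x \<bullet> y"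
        using car that by (intro bexI[of _ x]) (simp_all add: comm_def free_simps)
      show ?thesis if "z = finv x \<bullet> y"
        using car that by (intro bexI[of _ "finv x"]) (simp_all add: comm_def free_simps)
      show ?thesis if "z = y \<bullet> x"
        using car that by (intro bexI[of _ "\<one>\<^bsub>F2\<^esub>"]) (simp_all add: comm_def free_simps)
      show ?thesis if "z = y \<bullet> finv x"
        using car that by (intro bexI[of _ "\<one>\<^bsub>F2\<^esub>"]) (simp_all add: comm_def free_simps)
    qed
    then obtain j where j: "j \<in> carrier F2" "comm x z = j \<bullet> comm x y \<bullet> finv j" by blast
    show ?thesis
    proof (rule less.hyps)
      show "comm x z = (j \<bullet> k) \<bullet> comm_ab \<bullet> finv (j \<bullet> k)"
        using j car by (simp add: comm free_simps)
    qed (use that car j in auto)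
  qed
  show ?case
  proof (cases "reduced (x @ x)")
    case False
    then have hd_x: "hd x = inv_letter (last x)" using red by (auto simp: reduced_append)
    obtain l u where u: "x = l # u" using x by (cases x) auto
    then have "u \<noteq> []" using hd_x by auto
    then obtain z where z: "u = z @ [inv_letter l]"
      using hd_x u by (metis append_butlast_last_id inv_letter_inv_letter last_ConsR list.sel(1))
    have xz: "x = l # z @ [inv_letter l]" using u z by simp
    \<comment> \<open>Conjugation by this letter strips the first and the last letter of
      \<open>x\<close>.\<close>
    let ?k = "[inv_letter l]"
    have k: "?k \<in> carrier F2" "finv ?k = [l]"
      by (simp_all add: carrier_free_group finv_eq)
    have "reduced u" "reduced z" using red u z by (auto simp: reduced_Cons reduced_append)
    have "?k \<bullet> x = u" using u \<open>u \<noteq> []\<close> by (simp add: fmult_eq)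
    moreover have "u = z \<bullet> ?k"
      using fmult_eq_append[of z ?k] \<open>reduced u\<close> z by simp
    moreover have "z \<bullet> ?k \<bullet> finv ?k = z"
      using k(1) \<open>reduced z\<close> by (simp add: free.m_assoc flip: carrier_free_group)
    ultimately have "?k \<bullet> x \<bullet> finv ?k = z" by (simp only:)
    moreover have "length (?k \<bullet> y \<bullet> finv ?k) \<le> 2 + length y"
      using length_fmult[of "?k \<bullet> y" "finv ?k"] length_fmult[of ?k y] k by simp
    ultimately have "2 * length (?k \<bullet> x \<bullet> finv ?k) + length (?k \<bullet> y \<bullet> finv ?k)
        < 2 * length x + length y"
      by (simp add: xz)
    then have "R_pair_conj (?k \<bullet> x \<bullet> finv ?k) (?k \<bullet> y \<bullet> finv ?k)"
    proof (rule less.hyps)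
      show "comm (?k \<bullet> x \<bullet> finv ?k) (?k \<bullet> y \<bullet> finv ?k) = (?k \<bullet> k) \<bullet> comm_ab \<bullet> finv (?k \<bullet> k)"
        using comm_conj[OF car(1,2) k(1)] car k(1) by (simp add: comm free_simps)
    qed (use car k(1) in simp_all)
    then show ?thesis by (rule R_pair_conjI_conj[OF car(1,2)]) (rule k(1))
  next
    case cyc: True
    show ?thesis
    proof (cases "length y < length x")
      case True
      \<comment> \<open>With the weight 2 on the first component, moving the shorter word there
        lowers the measure.\<close>
      have "R_pair_conj y (finv x)"
      proof (rule less.hyps)
        have "comm y (finv x) = finv x \<bullet> comm x y \<bullet> finv (finv x)"
          using car by (simp add: comm_def free_simps)
        then show "comm y (finv x) = (finv x \<bullet> k) \<bullet> comm_ab \<bullet> finv (finv x \<bullet> k)"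
          using car by (simp add: comm free_simps)
      qed (use True car red in simp_all)
      then show ?thesis by (rule R_pair_conjI_rotate[OF car(1,2)])
    next
      case False
      show ?thesis
      proof (cases "\<exists>z\<in>{x \<bullet> y, y \<bullet> x, y \<bullet> finv x, finv x \<bullet> y}. length z < length y")
        case True
        then show ?thesis
          using shorter
          by (auto intro: R_pair_conjI_mult_left[OF car(1,2)] R_pair_conjI_mult_right[OF car(1,2)]
              R_pair_conjI_mult_inv_left[OF car(1,2)] R_pair_conjI_mult_inv_right[OF car(1,2)])
      next
        case minimal: False
        have "finv k \<bullet> comm x y \<bullet> finv (finv k) = comm_ab"
          using car by (simp add: comm free_simps)
        then have "length (finv k \<bullet> comm x y \<bullet> finv (finv k)) \<le> 4"
          by (simp add: comm_ab_eq)
        moreover have "reduced (finv k)"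
          using car(3) by (simp flip: carrier_free_group)
        ultimately have "length x = 1 \<and> length y = 1"
          using False minimal
          by (intro commutator_letters[OF red(1) x cyc red(2) y _ _ _ _ _ ne, of "finv k"])
            (auto simp: not_less)
        then obtain l m where "x = [l]" "y = [m]"
          by (auto simp: length_Suc_conv)
        then show ?thesis using R_pair_conj_letters comm car(3) by blast
      qed
    qed
  qed
qed

section \<open>The solutions of \<open>comm x y = comm_ab\<close> and the image of
  \<open>Pal\<close>\<close>

lemma R_pair_iff_comm:
  assumes "x \<in> carrier F2" "y \<in> carrier F2"
  shows "R_pair x y \<longleftrightarrow> comm x y = comm_ab"
proof
  assume c: "comm x y = comm_ab"
  then have "R_pair_conj x y"
    by (intro R_pair_conj_if_comm_conj[of x y "\<one>\<^bsub>F2\<^esub>"]) (simp_all add: assms)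
  then obtain k where k: "k \<in> carrier F2" "R_pair (k \<bullet> x \<bullet> finv k) (k \<bullet> y \<bullet> finv k)"
    by (auto simp: R_pair_conj_def)
  \<comment> \<open>Both pairs have commutator \<open>comm_ab\<close>, so the conjugating element
    centralizes it.\<close>
  have "k \<bullet> comm_ab \<bullet> finv k = comm_ab"
    using R_pair_comm[OF k(2)] comm_conj[OF assms k(1)] c by simp
  then have "finv (finv k) \<bullet> comm_ab \<bullet> finv k = comm_ab"
    using k(1) by simp
  then obtain n :: int where "finv k = comm_ab [^]\<^bsub>F2\<^esub> n"
    using centralizer_comm_ab[of "finv k"] k(1) by auto
  \<comment> \<open>Conjugating by \<open>finv k\<close>, now a power of \<open>comm_ab\<close>,
    undoes the conjugation by \<open>k\<close>.\<close>
  then show "R_pair x y"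
    using R_pair_conj_pow[OF k(2), of n] k(1) assms by (simp add: free_simps flip: \<open>finv k = _\<close>)
qed (rule R_pair_comm)

theorem theorem7p1:
  fixes g :: "gen letter list"
  assumes "g \<in> carrier F2"
  shows "g \<in> Pal ` carrier F2 \<longleftrightarrow>
    conjugate_in F2 (gen_a \<otimes>\<^bsub>F2\<^esub> gen_b \<otimes>\<^bsub>F2\<^esub> g) (gen_b \<otimes>\<^bsub>F2\<^esub> gen_a \<otimes>\<^bsub>F2\<^esub> g)"
proof
  assume "g \<in> Pal ` carrier F2"
  then obtain w where w: "w \<in> carrier F2" "g = Pal w" by blast
  define x y where "x = R_aut w gen_a" and "y = R_aut w gen_b"
  have car: "x \<in> carrier F2" "y \<in> carrier F2" using w by (simp_all add: x_def y_def)
  have "comm x y = comm_ab"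
    using w by (intro R_pair_comm) (auto simp: R_pair_def x_def y_def)
  have g: "gen_a \<bullet> gen_b \<bullet> g = x \<bullet> y"
    using w by (simp add: Pal_def R_aut_mult x_def y_def free_simps)
  \<comment> \<open>Left multiplication by the inverse commutator exchanges the first two factors;
    applied to \<open>x \<bullet> y\<close> it gives \<open>y \<bullet> x\<close>, the conjugate of
    \<open>x \<bullet> y\<close> by \<open>y\<close>.\<close>
  have "gen_b \<bullet> gen_a \<bullet> g = finv comm_ab \<bullet> (gen_a \<bullet> gen_b \<bullet> g)"
    using assms by (simp add: comm_def free_simps)
  also have "\<dots> = finv (comm x y) \<bullet> (x \<bullet> y)"
    by (simp only: g \<open>comm x y = comm_ab\<close>)
  also have "\<dots> = y \<bullet> (x \<bullet> y) \<bullet> finv y"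
    using car by (simp add: comm_def free_simps)
  finally show "conjugate_in F2 (gen_a \<bullet> gen_b \<bullet> g) (gen_b \<bullet> gen_a \<bullet> g)"
    unfolding conjugate_in_def g using car by blast
next
  assume "conjugate_in F2 (gen_a \<bullet> gen_b \<bullet> g) (gen_b \<bullet> gen_a \<bullet> g)"
  then obtain h where h: "h \<in> carrier F2"
      "gen_b \<bullet> gen_a \<bullet> g = h \<bullet> (gen_a \<bullet> gen_b \<bullet> g) \<bullet> finv h"
    by (auto simp: conjugate_in_def)
  define x where "x = gen_a \<bullet> gen_b \<bullet> g"
  have x: "x \<in> carrier F2" using assms by (simp add: x_def)
  \<comment> \<open>The last three factors of \<open>comm x h\<close> form the inverse of the
    conjugate of \<open>x\<close> by \<open>h\<close>; in the quotient of the two conjugate elements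
    \<open>g\<close> cancels.\<close>
  have "comm x h = x \<bullet> finv (gen_b \<bullet> gen_a \<bullet> g)"
    unfolding h(2) x_def[symmetric] using x h(1) by (simp add: comm_def free_simps)
  also have "\<dots> = comm_ab"
    using assms by (simp add: x_def comm_def free_simps)
  finally have "R_pair x h" using R_pair_iff_comm x h(1) by simp
  \<comment> \<open>The images of \<open>gen_a\<close> and \<open>gen_b\<close> have to multiply to
    \<open>x\<close>; with \<open>h\<close> as the second, the first is
    \<open>x \<bullet> finv h\<close>.\<close>
  then have "R_pair (x \<bullet> finv h) h" by (rule R_pair_mult)
  then obtain w where w: "w \<in> carrier F2" "x \<bullet> finv h = R_aut w gen_a" "h = R_aut w gen_b"
    by (auto simp: R_pair_def)
  have "R_aut w (gen_a \<bullet> gen_b) = (x \<bullet> finv h) \<bullet> h"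
    using w(1) by (simp add: R_aut_mult flip: w(2,3))
  also have "\<dots> = gen_a \<bullet> gen_b \<bullet> g"
    using x h(1) by (simp add: free_simps flip: x_def)
  finally have "Pal w = g"
    using assms by (simp add: Pal_def free_simps)
  then show "g \<in> Pal ` carrier F2" using w(1) by blast
qed

end
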